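(* Consider the $M$-group Curie-Weiss model with coupling matrix $J$. (1) If $J$ is homogeneous and the model is in the critical regime ($\beta=1$), then $$\left(\frac{S_1}{N_1},\ldots,\frac{S_M}{N_M}\right)\Longrightarrow\delta_0\quad\text{as }N\to\infty.$$ (2) If $M=2$, $J$ is heterogeneous, and the model is in the critical regime, then $$\left(\frac{S_1}{N_1},\frac{S_2}{N_2}\right)\Longrightarrow\delta_0\quad\text{as }N\to\infty.$$
   Context: Setting. Fix $M\in\mathbb{N}$. For each $N$ there are group sizes $N_1,\ldots,N_M\in\mathbb{N}$ with $\sum_\lambda N_\lambda=N$, and as $N\to\infty$ each $N_\lambda\to\infty$ and $N_\lambda/N\to\alpha_\lambda$, where $\alpha_\lambda\ge 0$ (possibly $0$) and $\sum_\lambda\alpha_\lambda=1$. For a fixed positive semi-definite real symmetric $M\times M$ coupling matrix $J=(J_{\lambda\mu})$, the $M$-group Curie-Weiss model is the collection of $\{-1,1\}$-valued random variables $X_{\lambda i}$ ($1\le\lambda\le M$, $1\le i\le N_\lambda$) with $$\mathbb{P}(X_{11}=x_{11},\ldots,X_{MN_M}=x_{MN_M})=Z^{-1}\exp\Big(\frac{1}{2N}\sum_{\lambda,\mu=1}^M J_{\lambda\mu}\sum_{i=1}^{N_\lambda}\sum_{j=1}^{N_\mu}x_{\lambda i}x_{\mu j}\Big),$$ $Z$ being the normalising constant. Put $S_\lambda=\sum_{i=1}^{N_\lambda}X_{\lambda i}$. Classes of coupling matrices. $J$ is homogeneous if all its entries equal one constant $\beta\ge0$; its critical regime is $\beta=1$.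 $J$ is heterogeneous if it is positive definite; with $\boldsymbol\alpha=\mathrm{diag}(\alpha_1,\ldots,\alpha_M)$ and $H=J^{-1}-\boldsymbol\alpha$, its critical regime is the case that $H$ is positive semi-definite but not positive definite. $\delta_0$ is the Dirac measure at the origin; $\Longrightarrow$ denotes weak convergence of the distributions. *)

theory Defs
  imports "HOL-Probability.Probability"
begin

definition pos_semidef :: "real^'m^'m \<Rightarrow> bool" where
  "pos_semidef A \<longleftrightarrow> transpose A = A \<and> (\<forall>x. 0 \<le> x \<bullet> (A *v x))"

definition pos_def :: "real^'m^'m \<Rightarrow> bool" where
  "pos_def A \<longleftrightarrow> transpose A = A \<and> (\<forall>x. x \<noteq> 0 \<longrightarrow> 0 < x \<bullet> (A *v x))"

definition diag_matrix :: "real^'m \<Rightarrow> real^'m^'m" where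
  "diag_matrix a = (\<chi> l m. if l = m then a $ l else 0)"

(* Groups are indexed by the finite type 'm, so M = CARD('m). Within group l the
   individuals are 1, ..., n l. PiE makes a configuration undefined outside this range,
   so that the set of configurations is finite. *)
definition spin_configs :: "('m::finite \<Rightarrow> nat) \<Rightarrow> ('m \<Rightarrow> nat \<Rightarrow> real) set" where
  "spin_configs n = {x. \<forall>l. x l \<in> {1..n l} \<rightarrow>\<^sub>E {-1, 1}}"

definition cw_weight :: "real^'m^'m \<Rightarrow> ('m \<Rightarrow> nat) \<Rightarrow> ('m \<Rightarrow> nat \<Rightarrow> real) \<Rightarrow> real" where
  "cw_weight J n x =
     exp (1 / (2 * real (\<Sum>l\<in>UNIV. n l)) *
          (\<Sum>l\<in>UNIV. \<Sum>m\<in>UNIV. J $ l $ m * (\<Sum>i=1..n l. \<Sum>j=1..n m. x l i * x m j)))"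

definition cw_partition :: "real^'m^'m \<Rightarrow> ('m \<Rightarrow> nat) \<Rightarrow> real" where
  "cw_partition J n = (\<Sum>x\<in>spin_configs n. cw_weight J n x)"

(* X l i is the spin of individual i in group l; values of X l i for i outside
   {1..n l} are irrelevant. *)
definition curie_weiss ::
  "real^'m^'m \<Rightarrow> ('m \<Rightarrow> nat) \<Rightarrow> 'a measure \<Rightarrow> ('m \<Rightarrow> nat \<Rightarrow> 'a \<Rightarrow> real) \<Rightarrow> bool" where
  "curie_weiss J n P X \<longleftrightarrow>
     prob_space P \<and>
     (\<forall>l. \<forall>i\<in>{1..n l}. X l i \<in> borel_measurable P \<and> (\<forall>\<omega>\<in>space P. X l i \<omega> \<in> {-1, 1})) \<and>
     (\<forall>x\<in>spin_configs n.
        measure P {\<omega> \<in> space P. \<forall>l. \<forall>i\<in>{1..n l}. X l i \<omega> = x l i}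
          = cw_weight J n x / cw_partition J n)"

definition normalised_sums ::
  "('m \<Rightarrow> nat) \<Rightarrow> ('m \<Rightarrow> nat \<Rightarrow> 'a \<Rightarrow> real) \<Rightarrow> 'a \<Rightarrow> real^'m" where
  "normalised_sums n X \<omega> = (\<chi> l. (\<Sum>i=1..n l. X l i \<omega>) / real (n l))"

definition homogeneous_coupling :: "real \<Rightarrow> real^'m^'m \<Rightarrow> bool" where
  "homogeneous_coupling \<beta> J \<longleftrightarrow> 0 \<le> \<beta> \<and> (\<forall>l m. J $ l $ m = \<beta>)"

definition heterogeneous_coupling :: "real^'m^'m \<Rightarrow> bool" where
  "heterogeneous_coupling J \<longleftrightarrow> pos_def J"

definition heterogeneous_critical :: "real^'m \<Rightarrow> real^'m^'m \<Rightarrow> bool" where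
  "heterogeneous_critical \<alpha> J \<longleftrightarrow>
     (let H = matrix_inv J - diag_matrix \<alpha> in pos_semidef H \<and> \<not> pos_def H)"

(* The library's weak_conv_m is based on distribution functions and covers only measures
   on the real line. *)
definition converges_weakly :: "(nat \<Rightarrow> 'b::topological_space measure) \<Rightarrow> 'b measure \<Rightarrow> bool"
  where
  "converges_weakly \<mu> \<nu> \<longleftrightarrow>
     (\<forall>f::'b \<Rightarrow> real. continuous_on UNIV f \<and> bounded (range f) \<longrightarrow>
        (\<lambda>N. \<integral>x. f x \<partial>\<mu> N) \<longlonglongrightarrow> (\<integral>x. f x \<partial>\<nu>))"

end

theory Submission
  imports Defs
begin

text \<open>Let \<open>h = J S / N\<close> be the vector of mean fields. Flipping a single spin shows that, up to \<open>O(1/N)\<close>,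
  a spin of group \<open>l\<close> may be replaced by \<open>tanh (h l)\<close> when its product with a slowly varying function
  is averaged. Taking \<open>h l\<close> for this function yields
  \<open>E (S \<bullet> h) / N \<approx> E (\<Sum>l. \<alpha> l * h l * tanh (h l))\<close>. In both critical regimes
  \<open>\<Sum>l. \<alpha> l * (h l)\<^sup>2 \<le> (S \<bullet> h) / N\<close>, so \<open>E (\<Sum>l. \<alpha> l * h l * (h l - tanh (h l)))\<close> tends to 0.
  The integrand vanishes only where \<open>h l = 0\<close> for all \<open>l\<close> with \<open>\<alpha> l > 0\<close>; hence \<open>E (S \<bullet> h) / N\<close> tends
  to 0, and with it, as \<open>J\<close> is positive semidefinite, all of \<open>h\<close>, including the groups with \<open>\<alpha> l = 0\<close>.
  Taking \<open>S l / n l\<close> for the function then bounds its second moment by \<open>E \<bar>h l\<bar>\<close>, up to a vanishing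
  error.\<close>

section \<open>Gibbs averages\<close>

definition spin_sum :: "('m::finite \<Rightarrow> nat) \<Rightarrow> ('m \<Rightarrow> nat \<Rightarrow> real) \<Rightarrow> real^'m" where
  "spin_sum n x = (\<chi> l. \<Sum>i=1..n l. x l i)"

text \<open>For symmetric \<open>J\<close> this is the gradient, with respect to the vector of group
  sums, of the exponent in \<open>cw_weight\<close>. Every component is divided by the total size
  and not by a group size, so the field stays bounded in each group, including those whose
  proportion tends to 0.\<close>

definition mean_field ::
  "real^'m^'m \<Rightarrow> ('m::finite \<Rightarrow> nat) \<Rightarrow> ('m \<Rightarrow> nat \<Rightarrow> real) \<Rightarrow> real^'m" where
  "mean_field J n x = (J *v spin_sum n x) /\<^sub>R real (\<Sum>l\<in>UNIV. n l)"

text \<open>Expectation under the Gibbs measure, written as a finite sum over configurations. It is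
  linear for arbitrary \<open>f\<close>, and the estimates can be carried out without the
  probability space; \<open>curie_weiss_expectation\<close> makes the link with integrals.\<close>

definition cw_mean ::
  "real^'m^'m \<Rightarrow> ('m::finite \<Rightarrow> nat) \<Rightarrow> (('m \<Rightarrow> nat \<Rightarrow> real) \<Rightarrow> real) \<Rightarrow> real" where
  "cw_mean J n f = (\<Sum>x\<in>spin_configs n. cw_weight J n x * f x) / cw_partition J n"

definition flip_spin :: "'m \<Rightarrow> nat \<Rightarrow> ('m \<Rightarrow> nat \<Rightarrow> real) \<Rightarrow> 'm \<Rightarrow> nat \<Rightarrow> real" where
  "flip_spin l i x = x(l := (x l)(i := - x l i))"

lemma finite_spin_configs: "finite (spin_configs (n :: 'm::finite \<Rightarrow> nat))"
proof -
  have "spin_configs n = PiE UNIV (\<lambda>l. {1..n l} \<rightarrow>\<^sub>E {-1, 1})"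
    by (auto simp: spin_configs_def PiE_UNIV_domain)
  then show ?thesis
    by (simp add: finite_PiE)
qed

lemma spin_configs_nonempty: "spin_configs (n :: 'm::finite \<Rightarrow> nat) \<noteq> {}"
proof -
  have "(\<lambda>l. \<lambda>i\<in>{1..n l}. 1) \<in> spin_configs n"
    by (auto simp: spin_configs_def)
  then show ?thesis by blast
qed

lemma spin_configs_values:
  "x \<in> spin_configs n \<Longrightarrow> i \<in> {1..n l} \<Longrightarrow> x l i = 1 \<or> x l i = -1"
  unfolding spin_configs_def using PiE_mem[of "x l" "{1..n l}" "\<lambda>_. {-1, 1}" i] by auto

lemma cw_weight_pos: "0 < cw_weight J n x"
  by (simp add: cw_weight_def)

lemma cw_partition_pos: "0 < cw_partition J (n :: 'm::finite \<Rightarrow> nat)"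
  unfolding cw_partition_def
  by (rule sum_pos) (auto simp: finite_spin_configs spin_configs_nonempty cw_weight_pos)

lemma cw_mean_const [simp]: "cw_mean J (n :: 'm::finite \<Rightarrow> nat) (\<lambda>x. c) = c"
  using cw_partition_pos[of J n]
  by (simp add: cw_mean_def cw_partition_def flip: sum_distrib_right)

lemma cw_mean_add: "cw_mean J n (\<lambda>x. f x + g x) = cw_mean J n f + cw_mean J n g"
  by (simp add: cw_mean_def sum.distrib distrib_left add_divide_distrib)

lemma cw_mean_cmult: "cw_mean J n (\<lambda>x. c * f x) = c * cw_mean J n f"
  by (simp add: cw_mean_def sum_distrib_left mult.left_commute)

lemma cw_mean_diff: "cw_mean J n (\<lambda>x. f x - g x) = cw_mean J n f - cw_mean J n g"
  by (simp add: cw_mean_def sum_subtractf right_diff_distrib diff_divide_distrib)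

lemma cw_mean_sum: "cw_mean J n (\<lambda>x. \<Sum>k\<in>A. f k x) = (\<Sum>k\<in>A. cw_mean J n (f k))"
  unfolding cw_mean_def
  by (simp add: sum_distrib_left sum.swap[of _ A] flip: sum_divide_distrib)

lemma cw_mean_mono:
  assumes "\<And>x. x \<in> spin_configs n \<Longrightarrow> f x \<le> g x"
  shows "cw_mean J (n :: 'm::finite \<Rightarrow> nat) f \<le> cw_mean J n g"
  unfolding cw_mean_def
  using assms cw_weight_pos[of J n] cw_partition_pos[of J n]
  by (intro divide_right_mono sum_mono mult_left_mono) (auto intro: less_imp_le)

lemma cw_mean_abs: "\<bar>cw_mean J (n :: 'm::finite \<Rightarrow> nat) f\<bar> \<le> cw_mean J n (\<lambda>x. \<bar>f x\<bar>)"
proof -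
  have "cw_mean J n f \<le> cw_mean J n (\<lambda>x. \<bar>f x\<bar>)"
    by (rule cw_mean_mono) simp
  moreover have "cw_mean J n (\<lambda>x. -1 * \<bar>f x\<bar>) \<le> cw_mean J n f"
    by (rule cw_mean_mono) simp
  ultimately show ?thesis
    unfolding cw_mean_cmult by simp
qed

lemma cw_mean_abs_bound:
  assumes "\<And>x. x \<in> spin_configs n \<Longrightarrow> \<bar>f x\<bar> \<le> c"
  shows "\<bar>cw_mean J (n :: 'm::finite \<Rightarrow> nat) f\<bar> \<le> c"
  using cw_mean_abs[of J n f] cw_mean_mono[of n "\<lambda>x. \<bar>f x\<bar>" "\<lambda>_. c" J] assms by auto

section \<open>Flipping a spin\<close>

lemma flip_spin_flip_spin [simp]: "flip_spin l i (flip_spin l i x) = x"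
  by (simp add: flip_spin_def)

lemma flip_spin_in_spin_configs:
  assumes "x \<in> spin_configs n" "i \<in> {1..n l}"
  shows "flip_spin l i x \<in> spin_configs n"
  using assms spin_configs_values[OF assms] unfolding spin_configs_def flip_spin_def
  by (auto simp: PiE_iff extensional_def)

lemma sum_flip_spin:
  assumes "i \<in> {1..n l}"
  shows "(\<Sum>x\<in>spin_configs n. f (flip_spin l i x)) = (\<Sum>x\<in>spin_configs n. f x)"
  by (rule sum.reindex_bij_witness[where i = "flip_spin l i" and j = "flip_spin l i"])
     (use assms in \<open>auto intro: flip_spin_in_spin_configs\<close>)

lemma spin_sum_flip_spin:
  assumes "i \<in> {1..n l}"
  shows "spin_sum n (flip_spin l i x) = spin_sum n x - axis l (2 * x l i)"
proof -
  have "(\<Sum>j=1..n l. flip_spin l i x l j) = (\<Sum>j=1..n l. x l j) - 2 * x l i"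
  proof -
    have "flip_spin l i x l j = x l j - (if j = i then 2 * x l i else 0)" for j
      by (simp add: flip_spin_def)
    then show ?thesis
      using assms by (simp add: sum_subtractf)
  qed
  then show ?thesis
    by (auto simp: vec_eq_iff spin_sum_def axis_def flip_spin_def)
qed

text \<open>Only one group sum moves, by twice the flipped spin, so each field moves by O(1/N). This
  is what makes the mean fields slowly varying functions.\<close>

lemma mean_field_flip_spin:
  assumes "i \<in> {1..n l}"
  shows "mean_field J n (flip_spin l i x) $ m =
    mean_field J n x $ m - 2 * x l i * J $ m $ l / real (\<Sum>l\<in>UNIV. n l)"
  by (simp add: mean_field_def spin_sum_flip_spin[where n = n and l = l, OF assms]
      matrix_vector_mult_diff_distrib divide_inverse inner_axis algebra_simps matrix_vector_mul_component[of J "axis _ _"])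

section \<open>The Gibbs weight as a quadratic form in the group sums\<close>

lemma cw_weight_eq:
  "cw_weight J n x = exp (spin_sum n x \<bullet> mean_field J n x / 2)"
proof -
  have prod: "(\<Sum>i=1..n l. \<Sum>j=1..n m. x l i * x m j) = spin_sum n x $ l * spin_sum n x $ m"
    for l m
    unfolding spin_sum_def vec_lambda_beta sum_product ..
  have quad: "(\<Sum>l\<in>UNIV. \<Sum>m\<in>UNIV. J $ l $ m * (s $ l * s $ m)) = s \<bullet> (J *v s)" for s
    unfolding inner_vec_def matrix_vector_mult_def vec_lambda_beta inner_real_def sum_distrib_left
    by (simp only: mult_ac)
  show ?thesis
    unfolding cw_weight_def prod quad mean_field_def inner_scaleR_right
    by (simp only: divide_inverse inverse_mult_distrib mult_ac mult_1_left)
qed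

text \<open>Expand the quadratic form at \<open>s - e\<close>, where \<open>e\<close> is the change
  of the group sums. The cross term produces the mean field, the square term the self-interaction of
  the spin. The bracket in the exponent is therefore the field due to all other spins.\<close>

lemma cw_weight_flip_spin:
  assumes sym: "transpose J = J" and i: "i \<in> {1..n l}" and x: "x \<in> spin_configs n"
  shows "cw_weight J n (flip_spin l i x) = cw_weight J n x *
    exp (- 2 * x l i * (mean_field J n x $ l - J $ l $ l * x l i / real (\<Sum>l\<in>UNIV. n l)))"
proof -
  define N where "N = real (\<Sum>l\<in>UNIV. n l)"
  define s where "s = spin_sum n x"
  define e :: "real^'a" where "e = axis l (2 * x l i)"
  have xi: "x l i * x l i = 1"
    using spin_configs_values[OF x i] by auto
  have sJ: "u \<bullet> (J *v v) = v \<bullet> (J *v u)" for u v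
    by (metis dot_lmul_matrix inner_commute sym vector_transpose_matrix)
  have eJ: "e \<bullet> (J *v s) = 2 * x l i * (J *v s) $ l"
    unfolding inner_commute[of e] by (simp add: e_def inner_axis)
  have ee: "e \<bullet> (J *v e) = 4 * J $ l $ l"
    using xi by (simp add: e_def inner_axis' matrix_vector_mul_component inner_axis)
  have "(s - e) \<bullet> (J *v (s - e)) = s \<bullet> (J *v s) - 2 * (e \<bullet> (J *v s)) + e \<bullet> (J *v e)"
    using sJ[of s e] by (simp add: matrix_vector_mult_diff_distrib inner_diff_left inner_diff_right)
  \<comment> \<open>The factor \<open>x l i * x l i\<close>, equal to 1, is put back so that the
    self-interaction can be taken into the bracket next to the mean field.\<close>
  also have "\<dots> = s \<bullet> (J *v s) - 4 * x l i * (J *v s) $ l + 4 * J $ l $ l * (x l i * x l i)"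
    using eJ ee xi by simp
  finally have eq: "(s - e) \<bullet> (J *v (s - e)) =
    s \<bullet> (J *v s) - 4 * x l i * (J *v s) $ l + 4 * J $ l $ l * (x l i * x l i)" .
  have weight: "cw_weight J n y = exp (spin_sum n y \<bullet> (J *v spin_sum n y) / N / 2)" for y
    by (simp only: cw_weight_eq mean_field_def inner_scaleR_right N_def divide_inverse mult_ac)
  have field: "mean_field J n x $ l = (J *v s) $ l / N"
    by (simp add: mean_field_def N_def s_def divide_inverse mult.commute del: of_nat_sum)
  have flip: "spin_sum n (flip_spin l i x) = s - e"
    unfolding s_def e_def by (rule spin_sum_flip_spin[where n = n and l = l, OF i])
  show ?thesis
    unfolding weight flip field exp_add[symmetric] s_def[symmetric] eq N_def[symmetric]
    by (rule arg_cong[where f = exp])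
       (simp add: add_divide_distrib diff_divide_distrib right_diff_distrib mult.assoc mult.left_commute)
qed

text \<open>A single spin in the field \<open>h\<close> takes the value \<open>s\<close> with
  probability (1 + \<open>s * tanh h\<close>) / 2, which is proportional to
  exp(\<open>s * h\<close>). The identity expresses the ratio of these two probabilities.\<close>

lemma sign_minus_tanh:
  fixes s h :: real
  assumes "s = 1 \<or> s = -1"
  shows "s - tanh h = exp (- 2 * s * h) * (s + tanh h)"
proof -
  have "exp h + exp (- h) > 0" by (simp add: add_pos_pos)
  then show ?thesis
    using assms by (auto simp: tanh_altdef field_simps simp flip: exp_add)
qed

lemma abs_tanh_le_1: "\<bar>tanh (u::real)\<bar> \<le> 1"
  using tanh_real_bounds[of u] by auto

lemma tanh_lipschitz: "\<bar>tanh u - tanh v\<bar> \<le> \<bar>u - (v::real)\<bar>"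
proof -
  have "norm (tanh u - tanh v) \<le> 1 * norm (u - v)"
  proof (rule field_differentiable_bound[of UNIV tanh "\<lambda>x. 1 - tanh x ^ 2" 1])
    fix z :: real
    show "norm (1 - (tanh z)\<^sup>2) \<le> 1"
      using abs_tanh_le_1[of z] by (auto simp: abs_square_le_1)
  qed (auto intro!: derivative_eq_intros)
  then show ?thesis by simp
qed

text \<open>Flipping one spin pairs the configurations: the local mean field does not see the flip, and
  the two weights are in the ratio that makes the tanh of that field the conditional mean
  of the spin.\<close>

lemma cw_mean_spin_minus_local_tanh:
  fixes n :: "'m::finite \<Rightarrow> nat"
  assumes sym: "transpose J = J" and i: "i \<in> {1..n l}"
    and f: "\<And>x. x \<in> spin_configs n \<Longrightarrow> \<bar>f x - f (flip_spin l i x)\<bar> \<le> c"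
  shows "\<bar>cw_mean J n (\<lambda>x. (x l i - tanh (mean_field J n x $ l -
      J $ l $ l * x l i / real (\<Sum>l\<in>UNIV. n l))) * f x)\<bar> \<le> c"
proof -
  define t where "t x = tanh (mean_field J n x $ l - J $ l $ l * x l i / real (\<Sum>l\<in>UNIV. n l))" for x
  let ?F = "flip_spin l i"
  let ?w = "cw_weight J n"
  have Fi: "?F x l i = - x l i" for x
    by (simp add: flip_spin_def)
  have tF: "t (?F x) = t x" for x
    unfolding t_def mean_field_flip_spin[where n = n and l = l, OF i] Fi
    by (rule arg_cong[where f = tanh]) (simp add: field_simps)
  have w: "?w x * (x l i - t x) = ?w (?F x) * (x l i + t x)" if "x \<in> spin_configs n" for x
    using cw_weight_flip_spin[OF sym i that] sign_minus_tanh[OF spin_configs_values[OF that i]]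
    by (simp add: t_def)
  have abs2: "\<bar>x l i + t x\<bar> \<le> 2" if "x \<in> spin_configs n" for x
  proof -
    have "\<bar>x l i + t x\<bar> \<le> \<bar>x l i\<bar> + \<bar>t x\<bar>" by (rule abs_triangle_ineq)
    moreover have "\<bar>x l i\<bar> = 1" using spin_configs_values[OF that i] by auto
    moreover have "\<bar>t x\<bar> \<le> 1" unfolding t_def by (rule abs_tanh_le_1)
    ultimately show ?thesis by linarith
  qed
  let ?S = "\<Sum>x\<in>spin_configs n. ?w x * ((x l i - t x) * f x)"
  \<comment> \<open>Add to the sum its copy reindexed by the flip. By the weight identity each
    configuration and its flip then share one factor, and \<open>f\<close> survives only through the
    difference \<open>f x - f (?F x)\<close>.\<close>
  have "2 * ?S = ?S + (\<Sum>x\<in>spin_configs n. ?w (?F x) * ((?F x l i - t (?F x)) * f (?F x)))"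
    using sum_flip_spin[where n = n and l = l, OF i, of "\<lambda>x. ?w x * ((x l i - t x) * f x)"] by simp
  also have "\<dots> = (\<Sum>x\<in>spin_configs n. ?w (?F x) * ((x l i + t x) * (f x - f (?F x))))"
    unfolding sum.distrib[symmetric]
  proof (rule sum.cong[OF refl])
    fix x assume x: "x \<in> spin_configs n"
    have "?w x * ((x l i - t x) * f x) = ?w (?F x) * (x l i + t x) * f x"
      using w[OF x] by (simp add: mult.assoc[symmetric])
    then show "?w x * ((x l i - t x) * f x) + ?w (?F x) * ((?F x l i - t (?F x)) * f (?F x))
        = ?w (?F x) * ((x l i + t x) * (f x - f (?F x)))"
      by (simp add: Fi tF algebra_simps)
  qed
  finally have "\<bar>2 * ?S\<bar> \<le> (\<Sum>x\<in>spin_configs n. \<bar>?w (?F x) * ((x l i + t x) * (f x - f (?F x)))\<bar>)"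
    by (simp only: sum_abs)
  \<comment> \<open>The bound 2 on \<open>x l i + t x\<close> is cancelled later by the doubling of
    the sum.\<close>
  also have "\<dots> \<le> (\<Sum>x\<in>spin_configs n. ?w (?F x) * (2 * c))"
    unfolding abs_mult using f abs2 cw_weight_pos[of J n]
    by (intro sum_mono mult_mono) (auto simp: less_imp_le)
  also have "\<dots> = cw_partition J n * (2 * c)"
    using sum_flip_spin[where n = n and l = l, OF i, of ?w] by (simp add: cw_partition_def flip: sum_distrib_right)
  finally have "\<bar>?S\<bar> \<le> cw_partition J n * c" by simp
  then show ?thesis
    using cw_partition_pos[of J n]
    by (simp add: cw_mean_def t_def field_simps)
qed

text \<open>Replaces the field of the other spins by the full mean field. As tanh is 1-Lipschitz,
  the self-interaction costs at most \<open>J $ l $ l\<close> / N in absolute value, times the bound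
  on \<open>f\<close>.\<close>

lemma cw_mean_spin_minus_tanh:
  fixes n :: "'m::finite \<Rightarrow> nat"
  assumes sym: "transpose J = J" and i: "i \<in> {1..n l}"
    and f: "\<And>x. x \<in> spin_configs n \<Longrightarrow> \<bar>f x - f (flip_spin l i x)\<bar> \<le> c"
    and B: "\<And>x. x \<in> spin_configs n \<Longrightarrow> \<bar>f x\<bar> \<le> B"
  shows "\<bar>cw_mean J n (\<lambda>x. (x l i - tanh (mean_field J n x $ l)) * f x)\<bar>
    \<le> c + \<bar>J $ l $ l\<bar> * B / real (\<Sum>l\<in>UNIV. n l)"
proof -
  define N where "N = real (\<Sum>l\<in>UNIV. n l)"
  define t where "t x = tanh (mean_field J n x $ l - J $ l $ l * x l i / N)" for x
  define t' where "t' x = tanh (mean_field J n x $ l)" for x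
  have "\<bar>(t x - t' x) * f x\<bar> \<le> \<bar>J $ l $ l\<bar> / N * B" if x: "x \<in> spin_configs n" for x
  proof -
    have "\<bar>t x - t' x\<bar> \<le> \<bar>J $ l $ l * x l i / N\<bar>"
      unfolding t_def t'_def
      using tanh_lipschitz[of "mean_field J n x $ l - J $ l $ l * x l i / N" "mean_field J n x $ l"]
      by simp
    also have "\<dots> = \<bar>J $ l $ l\<bar> / N"
      using spin_configs_values[OF x i] by (auto simp: abs_mult N_def abs_divide simp del: of_nat_sum)
    finally show ?thesis
      unfolding abs_mult using B[OF x] by (intro mult_mono) (auto simp: N_def)
  qed
  then have 1: "\<bar>cw_mean J n (\<lambda>x. (t x - t' x) * f x)\<bar> \<le> \<bar>J $ l $ l\<bar> / N * B"
    by (rule cw_mean_abs_bound)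
  have 2: "\<bar>cw_mean J n (\<lambda>x. (x l i - t x) * f x)\<bar> \<le> c"
    using cw_mean_spin_minus_local_tanh[where n = n and l = l and f = f, OF sym i f] by (simp add: t_def N_def)
  have "cw_mean J n (\<lambda>x. (x l i - t' x) * f x)
      = cw_mean J n (\<lambda>x. (x l i - t x) * f x) + cw_mean J n (\<lambda>x. (t x - t' x) * f x)"
    unfolding cw_mean_add[symmetric] by (simp add: algebra_simps)
  with 1 2 show ?thesis
    by (simp add: t'_def N_def)
qed

text \<open>Adds up the single-spin estimates over a group. The total error stays bounded as soon as
  \<open>c\<close> is of order 1/N, because a group has at most N members.\<close>

lemma cw_mean_spin_sum_minus_tanh:
  fixes n :: "'m::finite \<Rightarrow> nat"
  assumes sym: "transpose J = J"
    and f: "\<And>x i. x \<in> spin_configs n \<Longrightarrow> i \<in> {1..n l} \<Longrightarrow> \<bar>f x - f (flip_spin l i x)\<bar> \<le> c"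
    and B: "\<And>x. x \<in> spin_configs n \<Longrightarrow> \<bar>f x\<bar> \<le> B"
  shows "\<bar>cw_mean J n (\<lambda>x. (spin_sum n x $ l - n l * tanh (mean_field J n x $ l)) * f x)\<bar>
    \<le> n l * (c + \<bar>J $ l $ l\<bar> * B / real (\<Sum>l\<in>UNIV. n l))"
proof -
  have "(\<lambda>x. (spin_sum n x $ l - n l * tanh (mean_field J n x $ l)) * f x)
      = (\<lambda>x. \<Sum>i=1..n l. (x l i - tanh (mean_field J n x $ l)) * f x)"
    by (simp add: fun_eq_iff spin_sum_def sum_subtractf flip: sum_distrib_right)
  then have "\<bar>cw_mean J n (\<lambda>x. (spin_sum n x $ l - n l * tanh (mean_field J n x $ l)) * f x)\<bar>
      \<le> (\<Sum>i=1..n l. \<bar>cw_mean J n (\<lambda>x. (x l i - tanh (mean_field J n x $ l)) * f x)\<bar>)"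
    by (simp only: cw_mean_sum sum_abs)
  also have "\<dots> \<le> (\<Sum>i=1..n l. c + \<bar>J $ l $ l\<bar> * B / real (\<Sum>l\<in>UNIV. n l))"
    by (intro sum_mono cw_mean_spin_minus_tanh sym f B)
  finally show ?thesis by simp
qed

section \<open>Uniform bounds on group sums and mean fields\<close>

lemma abs_spin_sum_le:
  assumes "x \<in> spin_configs n"
  shows "\<bar>spin_sum n x $ l\<bar> \<le> n l"
proof -
  have "\<bar>spin_sum n x $ l\<bar> \<le> (\<Sum>i=1..n l. \<bar>x l i\<bar>)"
    by (simp add: spin_sum_def sum_abs)
  also have "\<dots> \<le> (\<Sum>i=1..n l. 1)"
    using spin_configs_values[OF assms] by (intro sum_mono) fastforce
  finally show ?thesis by simp
qed

text \<open>The bound is crude, but it depends neither on the group sizes nor on \<open>l\<close>: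
  all fields lie in one compact interval, on which \<open>square_le_tanh_gap\<close> can be
  applied.\<close>

lemma abs_mean_field_le:
  fixes n :: "'m::finite \<Rightarrow> nat"
  assumes x: "x \<in> spin_configs n"
  shows "\<bar>mean_field J n x $ l\<bar> \<le> (\<Sum>k\<in>UNIV. \<Sum>m\<in>UNIV. \<bar>J $ k $ m\<bar>)"
proof -
  define N where "N = real (\<Sum>l\<in>UNIV. n l)"
  have "\<bar>J $ l $ m * spin_sum n x $ m / N\<bar> \<le> \<bar>J $ l $ m\<bar>" for m
  proof -
    have "real (n m) \<le> N"
      unfolding N_def by (subst of_nat_le_iff) (rule member_le_sum, auto)
    with abs_spin_sum_le[OF x, of m] have "\<bar>spin_sum n x $ m / N\<bar> \<le> 1"
      by (auto simp: divide_le_eq_1)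
    then show ?thesis
      by (metis abs_ge_zero abs_mult mult_left_le times_divide_eq_right)
  qed
  then have "(\<Sum>m\<in>UNIV. \<bar>J $ l $ m * spin_sum n x $ m / N\<bar>) \<le> (\<Sum>m\<in>UNIV. \<bar>J $ l $ m\<bar>)"
    by (intro sum_mono) auto
  moreover have "mean_field J n x $ l = (\<Sum>m\<in>UNIV. J $ l $ m * spin_sum n x $ m / N)"
    by (simp add: mean_field_def matrix_vector_mult_def N_def divide_inverse sum_distrib_left mult_ac)
  then have "\<bar>mean_field J n x $ l\<bar> \<le> (\<Sum>m\<in>UNIV. \<bar>J $ l $ m * spin_sum n x $ m / N\<bar>)"
    by (simp only: sum_abs)
  moreover have "(\<Sum>m\<in>UNIV. \<bar>J $ l $ m\<bar>) \<le> (\<Sum>k\<in>UNIV. \<Sum>m\<in>UNIV. \<bar>J $ k $ m\<bar>)"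
    by (rule member_le_sum) (auto intro: sum_nonneg)
  ultimately show ?thesis by linarith
qed

section \<open>The law of large numbers in mean square\<close>

lemma tanh_gap_pos:
  fixes u :: real
  assumes "u \<noteq> 0"
  shows "0 < u * (u - tanh u)"
proof -
  have pos: "tanh v < v" if "v > 0" for v :: real
  proof -
    have "(\<lambda>x. x - tanh x) 0 < (\<lambda>x. x - tanh x) v"
    proof (rule DERIV_pos_imp_increasing_open[OF that])
      fix x :: real assume "0 < x" "x < v"
      then show "\<exists>y. ((\<lambda>x. x - tanh x) has_real_derivative y) (at x) \<and> 0 < y"
        \<comment> \<open>The derivative of \<open>x - tanh x\<close> is the square of
          \<open>tanh x\<close>. Negative arguments follow because the function is odd.\<close>
        by (intro exI[of _ "tanh x ^ 2"]) (auto intro!: derivative_eq_intros)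
    qed (auto intro!: continuous_intros)
    then show ?thesis by simp
  qed
  show ?thesis
  proof (cases "u > 0")
    case True
    then show ?thesis using pos[of u] by simp
  next
    case False
    then show ?thesis using pos[of "-u"] assms by (intro mult_neg_neg) auto
  qed
qed

lemma tanh_gap_nonneg: "0 \<le> u * (u - tanh (u::real))"
  using tanh_gap_pos[of u] by (cases "u = 0") auto

text \<open>Near 0 the gap is only of order u^4, so u^2 cannot be bounded by a multiple of it; the
  small u are absorbed by \<epsilon>. On the remaining compact set the gap is continuous and
  positive, hence has a positive minimum, and \<open>C\<close> is \<open>K\<close> squared over that
  minimum.\<close>

lemma square_le_tanh_gap:
  fixes K \<epsilon> :: real
  assumes "0 < \<epsilon>"
  shows "\<exists>C\<ge>0. \<forall>u. \<bar>u\<bar> \<le> K \<longrightarrow> u\<^sup>2 \<le> \<epsilon> + C * (u * (u - tanh u))"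
proof -
  define \<psi> :: "real \<Rightarrow> real" where "\<psi> = (\<lambda>u. u * (u - tanh u))"
  have pos: "0 < \<psi> u" if "u \<noteq> 0" for u
    unfolding \<psi>_def by (rule tanh_gap_pos[OF that])
  have nonneg: "0 \<le> \<psi> u" for u
    unfolding \<psi>_def by (rule tanh_gap_nonneg)
  have cont: "continuous_on A \<psi>" for A
    unfolding \<psi>_def by (intro continuous_on_mult continuous_on_diff continuous_on_id continuous_on_tanh) simp
  define S where "S = {-K..K} \<inter> {u. \<epsilon> \<le> u\<^sup>2}"
  have S: "u \<in> S \<longleftrightarrow> \<bar>u\<bar> \<le> K \<and> \<epsilon> \<le> u\<^sup>2" for u
    by (auto simp: S_def)
  have "compact S"
    unfolding S_def by (intro compact_Int_closed closed_Collect_le continuous_intros compact_Icc)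
  have "\<exists>C\<ge>0. \<forall>u\<in>S. u\<^sup>2 \<le> C * \<psi> u"
  proof (cases "S = {}")
    case False
    from continuous_attains_inf[OF \<open>compact S\<close> False cont]
    obtain v where v: "v \<in> S" and min: "\<forall>u\<in>S. \<psi> v \<le> \<psi> u" ..
    have "0 < \<psi> v"
      using v assms by (intro pos) (auto simp: S)
    have "u\<^sup>2 \<le> K\<^sup>2 / \<psi> v * \<psi> u" if "u \<in> S" for u
    proof -
      have "u\<^sup>2 = \<bar>u\<bar>\<^sup>2" by simp
      also have "\<dots> \<le> K\<^sup>2"
        using that by (intro power_mono) (simp_all add: S)
      also have "\<dots> = K\<^sup>2 / \<psi> v * \<psi> v"
        using \<open>0 < \<psi> v\<close> by simp
      also have "\<dots> \<le> K\<^sup>2 / \<psi> v * \<psi> u"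
        using min that nonneg by (intro mult_left_mono) simp_all
      finally show ?thesis .
    qed
    then show ?thesis
      using nonneg by (intro exI[of _ "K\<^sup>2 / \<psi> v"]) simp
  qed auto
  then obtain C where C: "0 \<le> C" "\<And>u. u \<in> S \<Longrightarrow> u\<^sup>2 \<le> C * \<psi> u" by blast
  have "u\<^sup>2 \<le> \<epsilon> + C * \<psi> u" if "\<bar>u\<bar> \<le> K" for u
  proof (cases "u \<in> S")
    case True
    with C(2) assms show ?thesis by fastforce
  next
    case False
    with that have "u\<^sup>2 \<le> \<epsilon>" by (simp add: S)
    with mult_nonneg_nonneg[OF C(1) nonneg[of u]] show ?thesis by linarith
  qed
  with C(1) show ?thesis unfolding \<psi>_def by blast
qed

text \<open>The constant may blow up as \<epsilon> tends to 0: \<epsilon> is fixed first, and only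
  then does \<open>a k\<close> become small enough to beat \<open>C\<close>.\<close>

lemma tendsto_zero_comparison:
  fixes a b :: "nat \<Rightarrow> real"
  assumes a: "a \<longlonglongrightarrow> 0"
    and le: "\<And>\<epsilon>. 0 < \<epsilon> \<Longrightarrow> \<exists>C. \<forall>\<^sub>F k in sequentially. \<bar>b k\<bar> \<le> \<epsilon> + C * a k"
  shows "b \<longlonglongrightarrow> 0"
proof (rule tendstoI)
  fix e :: real assume "0 < e"
  then obtain C where C: "\<forall>\<^sub>F k in sequentially. \<bar>b k\<bar> \<le> e / 2 + C * a k"
    using le[of "e / 2"] by auto
  have "(\<lambda>k. C * a k) \<longlonglongrightarrow> 0"
    by (rule tendsto_mult_right_zero[OF a])
  then have "\<forall>\<^sub>F k in sequentially. C * a k < e / 2"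
    by (rule order_tendstoD) (use \<open>0 < e\<close> in simp)
  with C show "\<forall>\<^sub>F k in sequentially. dist (b k) 0 < e"
    by eventually_elim (simp add: dist_real_def)
qed

text \<open>The form is nonnegative at \<open>v - e\<close>, with \<open>e\<close> a multiple of a
  unit vector. It controls every mean field by the quadratic form, whatever the proportion of its
  group.\<close>

lemma pos_semidef_component_le:
  fixes J :: "real^'m^'m"
  assumes "pos_semidef J"
  shows "((J *v v) $ l)\<^sup>2 \<le> (1 + \<bar>J $ l $ l\<bar>) * (v \<bullet> (J *v v))"
proof -
  \<comment> \<open>Minimising over the step along the axis would give 1 / \<open>J $ l $ l\<close>;
    the added 1 avoids a zero denominator and still yields \<open>r * J $ l $ l\<close> at most
    1.\<close>
  define r where "r = 1 / (1 + \<bar>J $ l $ l\<bar>)"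
  define h where "h = (J *v v) $ l"
  define e where "e = axis l (r * h)"
  have sym: "transpose J = J" using assms by (simp add: pos_semidef_def)
  have sJ: "v \<bullet> (J *v e) = e \<bullet> (J *v v)"
    by (metis dot_lmul_matrix inner_commute sym vector_transpose_matrix)
  have ev: "e \<bullet> (J *v v) = r * h * h"
    by (simp add: e_def inner_axis' h_def)
  have ee: "e \<bullet> (J *v e) = r * h * h * (r * J $ l $ l)"
    by (simp add: e_def inner_axis' matrix_vector_mul_component inner_axis)
  have r: "0 < r" "r * J $ l $ l \<le> 1"
    by (auto simp: r_def field_simps)
  have "0 \<le> (v - e) \<bullet> (J *v (v - e))"
    using assms by (simp add: pos_semidef_def)
  also have "\<dots> = v \<bullet> (J *v v) - 2 * (r * h * h) + r * h * h * (r * J $ l $ l)"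
    using sJ ev ee by (simp add: matrix_vector_mult_diff_distrib inner_diff_left inner_diff_right)
  also have "\<dots> \<le> v \<bullet> (J *v v) - 2 * (r * h * h) + r * h * h * 1"
    using r by (intro add_left_mono mult_left_mono) (auto simp: mult.assoc)
  finally have "r * h\<^sup>2 \<le> v \<bullet> (J *v v)"
    by (simp add: power2_eq_square mult_ac)
  then show ?thesis
    unfolding h_def[symmetric] by (simp add: r_def field_simps)
qed

text \<open>Criticality enters through \<open>dom\<close>, the inequality common to both regimes.
  Evaluated at the group sums over N, it bounds the weighted squares of the mean fields by the
  quadratic form of the model.\<close>

lemma cw_mean_square_normalised_sum_tendsto_0:
  fixes J :: "real^'m^'m" and \<alpha> :: "real^'m" and n :: "nat \<Rightarrow> 'm \<Rightarrow> nat"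
  assumes psd: "pos_semidef J"
    and total: "\<And>N. N \<ge> 1 \<Longrightarrow> (\<Sum>l\<in>UNIV. n N l) = N"
    and infty: "\<And>l. filterlim (\<lambda>N. n N l) at_top sequentially"
    and ratio: "\<And>l. (\<lambda>N. real (n N l) / real N) \<longlonglongrightarrow> \<alpha> $ l"
    and \<alpha>: "\<And>l. 0 \<le> \<alpha> $ l"
    and dom: "\<And>v. (\<Sum>l\<in>UNIV. \<alpha> $ l * ((J *v v) $ l)\<^sup>2) \<le> v \<bullet> (J *v v)"
  shows "(\<lambda>N. cw_mean J (n N) (\<lambda>x. (spin_sum (n N) x $ l / real (n N l))\<^sup>2)) \<longlonglongrightarrow> 0"
proof -
  have sym: "transpose J = J" using psd by (simp add: pos_semidef_def)
  define K where "K = (\<Sum>k\<in>UNIV. \<Sum>m\<in>UNIV. \<bar>J $ k $ m\<bar>)"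
  define E where "E N = cw_mean J (n N)" for N
  define s where "s N x = spin_sum (n N) x" for N x
  define h where "h N x = mean_field J (n N) x" for N x
  define a where "a N l = real (n N l) / real N" for N l
  \<comment> \<open>\<open>r\<close> is the error of replacing spins by tanh when testing against
    the field, \<open>q\<close> the mean of field times tanh, \<open>g\<close> the weighted gap, and
    \<open>D\<close> the mean of the quadratic form.\<close>
  define r where "r N l = E N (\<lambda>x. (s N x $ l / N - a N l * tanh (h N x $ l)) * h N x $ l)" for N l
  define q where "q N l = E N (\<lambda>x. h N x $ l * tanh (h N x $ l))" for N l
  define g where "g N l = E N (\<lambda>x. \<alpha> $ l * (h N x $ l * (h N x $ l - tanh (h N x $ l))))" for N l
  define D where "D N = E N (\<lambda>x. \<Sum>l\<in>UNIV. s N x $ l / N * h N x $ l)" for N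
  have hK: "\<bar>h N x $ l\<bar> \<le> K" if "x \<in> spin_configs (n N)" for N x l
    unfolding h_def K_def by (rule abs_mean_field_le[OF that])
  have total': "real (\<Sum>l\<in>UNIV. n N l) = real N" if "N \<ge> 1" for N
    using total[OF that] by simp
  have nN: "n N l \<le> N" if "N \<ge> 1" for N l
  proof -
    have "n N l \<le> (\<Sum>l\<in>UNIV. n N l)" by (rule member_le_sum) auto
    with total[OF that] show ?thesis by simp
  qed
  \<comment> \<open>The test function is the field of the group itself. A flip moves it by O(1/N),
    so the group error is bounded, and the prefactor 1/N makes \<open>r\<close> vanish.\<close>
  have r_bound: "\<bar>r N l\<bar> \<le> (2 * \<bar>J $ l $ l\<bar> + \<bar>J $ l $ l\<bar> * K) / N" if N: "N \<ge> 1" for N l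
  proof -
    have "\<bar>E N (\<lambda>x. (s N x $ l - n N l * tanh (h N x $ l)) * h N x $ l)\<bar>
        \<le> n N l * (2 * \<bar>J $ l $ l\<bar> / N + \<bar>J $ l $ l\<bar> * K / N)"
      unfolding E_def s_def h_def total'[OF N, symmetric]
    proof (rule cw_mean_spin_sum_minus_tanh[OF sym])
      fix x i assume x: "x \<in> spin_configs (n N)" and i: "i \<in> {1..n N l}"
      show "\<bar>mean_field J (n N) x $ l - mean_field J (n N) (flip_spin l i x) $ l\<bar>
          \<le> 2 * \<bar>J $ l $ l\<bar> / real (\<Sum>l\<in>UNIV. n N l)"
        unfolding mean_field_flip_spin[where n = "n N" and l = l, OF i]
        using spin_configs_values[OF x i] by (auto simp: abs_mult abs_divide simp del: of_nat_sum)
    qed (use hK[of _ N] in \<open>simp add: h_def\<close>)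
    also have "\<dots> \<le> N * (2 * \<bar>J $ l $ l\<bar> / N + \<bar>J $ l $ l\<bar> * K / N)"
      using nN[OF N] by (intro mult_right_mono) (auto simp: K_def intro!: add_nonneg_nonneg divide_nonneg_nonneg mult_nonneg_nonneg sum_nonneg)
    also have "\<dots> = 2 * \<bar>J $ l $ l\<bar> + \<bar>J $ l $ l\<bar> * K"
      using N by (simp add: field_simps)
    finally have 1: "\<bar>E N (\<lambda>x. (s N x $ l - n N l * tanh (h N x $ l)) * h N x $ l)\<bar>
        \<le> 2 * \<bar>J $ l $ l\<bar> + \<bar>J $ l $ l\<bar> * K" .
    have "r N l = E N (\<lambda>x. (1 / N) * ((s N x $ l - n N l * tanh (h N x $ l)) * h N x $ l))"
      unfolding r_def by (simp add: a_def field_simps diff_divide_distrib)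
    also have "\<dots> = (1 / N) * E N (\<lambda>x. (s N x $ l - n N l * tanh (h N x $ l)) * h N x $ l)"
      unfolding E_def by (rule cw_mean_cmult)
    finally show ?thesis
      using 1 by (simp add: abs_mult divide_right_mono)
  qed
  have r0: "(\<lambda>N. r N l) \<longlonglongrightarrow> 0" for l
  proof (rule Lim_null_comparison)
    show "\<forall>\<^sub>F N in sequentially. norm (r N l) \<le> (2 * \<bar>J $ l $ l\<bar> + \<bar>J $ l $ l\<bar> * K) / N"
      using eventually_ge_at_top[of 1] by eventually_elim (use r_bound in simp)
    show "(\<lambda>N. (2 * \<bar>J $ l $ l\<bar> + \<bar>J $ l $ l\<bar> * K) / real N) \<longlonglongrightarrow> 0"
      by (rule lim_const_over_n)
  qed
  have q_bound: "\<bar>q N l\<bar> \<le> K" for N l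
    unfolding q_def E_def
  proof (rule cw_mean_abs_bound)
    fix x assume "x \<in> spin_configs (n N)"
    then have "\<bar>h N x $ l\<bar> * \<bar>tanh (h N x $ l)\<bar> \<le> K * 1"
      using abs_tanh_le_1 hK[of x N l] by (intro mult_mono) auto
    then show "\<bar>h N x $ l * tanh (h N x $ l)\<bar> \<le> K"
      by (simp add: abs_mult)
  qed
  have aq0: "(\<lambda>N. (a N l - \<alpha> $ l) * q N l) \<longlonglongrightarrow> 0" for l
  proof (rule Lim_null_comparison)
    show "\<forall>\<^sub>F N in sequentially. norm ((a N l - \<alpha> $ l) * q N l) \<le> \<bar>a N l - \<alpha> $ l\<bar> * K"
      using q_bound by (intro always_eventually allI) (simp add: abs_mult mult_left_mono)
    have "(\<lambda>N. \<bar>a N l - \<alpha> $ l\<bar>) \<longlonglongrightarrow> 0"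
      using ratio[of l] unfolding a_def by (intro tendsto_rabs_zero) (simp add: LIM_zero)
    then show "(\<lambda>N. \<bar>a N l - \<alpha> $ l\<bar> * K) \<longlonglongrightarrow> 0"
      by (rule tendsto_mult_left_zero)
  qed
  \<comment> \<open>An exact identity: the error \<open>r\<close> is by definition what separates
    the two sides.\<close>
  have D_eq: "D N = (\<Sum>l\<in>UNIV. r N l + a N l * q N l)" for N
    unfolding D_def r_def q_def E_def cw_mean_sum cw_mean_cmult[symmetric] cw_mean_add[symmetric]
    by (simp add: algebra_simps)
  have dom_h: "(\<Sum>l\<in>UNIV. \<alpha> $ l * (h N x $ l)\<^sup>2) \<le> (\<Sum>l\<in>UNIV. s N x $ l / N * h N x $ l)"
    and h_le: "(h N x $ l)\<^sup>2 \<le> (1 + \<bar>J $ l $ l\<bar>) * (\<Sum>l\<in>UNIV. s N x $ l / N * h N x $ l)"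
    if N: "N \<ge> 1" for N x l
  proof -
    define v where "v = s N x /\<^sub>R N"
    have Jv: "J *v v = h N x"
      using total'[OF N] by (simp add: v_def h_def mean_field_def s_def matrix_vector_mult_scaleR)
    have "v \<bullet> (J *v v) = (\<Sum>l\<in>UNIV. s N x $ l / N * h N x $ l)"
      unfolding Jv by (simp add: v_def inner_vec_def divide_inverse mult_ac)
    then show "(\<Sum>l\<in>UNIV. \<alpha> $ l * (h N x $ l)\<^sup>2) \<le> (\<Sum>l\<in>UNIV. s N x $ l / N * h N x $ l)"
      "(h N x $ l)\<^sup>2 \<le> (1 + \<bar>J $ l $ l\<bar>) * (\<Sum>l\<in>UNIV. s N x $ l / N * h N x $ l)"
      using dom[of v] pos_semidef_component_le[OF psd, of v l] by (simp_all add: Jv)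
  qed
  have g_nonneg: "0 \<le> g N l" for N l
    using cw_mean_mono[of "n N" "\<lambda>_. 0" "\<lambda>x. \<alpha> $ l * (h N x $ l * (h N x $ l - tanh (h N x $ l)))" J]
      \<alpha> tanh_gap_nonneg unfolding g_def E_def by simp
  \<comment> \<open>Domination bounds the squares in the gap by \<open>D\<close>. Inserting
    \<open>D_eq\<close> cancels the main terms and leaves only vanishing errors, while each
    \<open>g\<close> is nonnegative.\<close>
  have g_le: "(\<Sum>l\<in>UNIV. g N l) \<le> (\<Sum>l\<in>UNIV. r N l + (a N l - \<alpha> $ l) * q N l)" if N: "N \<ge> 1" for N
  proof -
    have "(\<Sum>l\<in>UNIV. g N l) = E N (\<lambda>x. (\<Sum>l\<in>UNIV. \<alpha> $ l * (h N x $ l)\<^sup>2)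
        - (\<Sum>l\<in>UNIV. \<alpha> $ l * (h N x $ l * tanh (h N x $ l))))"
      unfolding g_def E_def cw_mean_sum[symmetric]
      by (simp add: sum_subtractf[symmetric] right_diff_distrib power2_eq_square)
    also have "\<dots> \<le> E N (\<lambda>x. (\<Sum>l\<in>UNIV. s N x $ l / N * h N x $ l)
        - (\<Sum>l\<in>UNIV. \<alpha> $ l * (h N x $ l * tanh (h N x $ l))))"
      unfolding E_def using dom_h[OF N] by (intro cw_mean_mono diff_right_mono)
    also have "\<dots> = D N - (\<Sum>l\<in>UNIV. \<alpha> $ l * q N l)"
      unfolding D_def q_def E_def by (simp add: cw_mean_diff cw_mean_sum cw_mean_cmult)
    also have "\<dots> = (\<Sum>l\<in>UNIV. r N l + (a N l - \<alpha> $ l) * q N l)"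
      unfolding D_eq sum_subtractf[symmetric] by (simp add: algebra_simps)
    finally show ?thesis .
  qed
  have g0: "(\<lambda>N. g N l) \<longlonglongrightarrow> 0" for l
  proof (rule Lim_null_comparison)
    show "\<forall>\<^sub>F N in sequentially. norm (g N l) \<le> (\<Sum>l\<in>UNIV. r N l + (a N l - \<alpha> $ l) * q N l)"
      using eventually_ge_at_top[of 1]
    proof eventually_elim
      case (elim N)
      have "g N l \<le> (\<Sum>l\<in>UNIV. g N l)"
        by (rule member_le_sum) (auto simp: g_nonneg)
      with g_le[OF elim] g_nonneg[of N l] show ?case by simp
    qed
    show "(\<lambda>N. \<Sum>l\<in>UNIV. r N l + (a N l - \<alpha> $ l) * q N l) \<longlonglongrightarrow> 0"
      by (rule tendsto_null_sum) (rule tendsto_add_zero[OF r0 aq0])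
  qed
  have alq0: "(\<lambda>N. \<alpha> $ l * q N l) \<longlonglongrightarrow> 0" for l
  proof (rule tendsto_zero_comparison[OF g0[of l]])
    fix \<epsilon> :: real assume \<epsilon>: "0 < \<epsilon>"
    \<comment> \<open>Chosen so that \<open>\<alpha> $ l * \<delta>\<close> is at most \<epsilon>;
      the 1 covers the case of proportion 0.\<close>
    define \<delta> where "\<delta> = \<epsilon> / (1 + \<alpha> $ l)"
    have \<delta>: "0 < \<delta>" "\<alpha> $ l * \<delta> \<le> \<epsilon>"
      using \<epsilon> \<alpha>[of l] by (auto simp: \<delta>_def field_simps)
    obtain C where C: "\<And>u. \<bar>u\<bar> \<le> K \<Longrightarrow> u\<^sup>2 \<le> \<delta> + C * (u * (u - tanh u))"
      using square_le_tanh_gap[OF \<delta>(1), of K] by blast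
    have "\<bar>\<alpha> $ l * q N l\<bar> \<le> \<epsilon> + C * g N l" for N
    proof -
      have le: "0 \<le> \<alpha> $ l * (u * tanh u)"
        "\<alpha> $ l * (u * tanh u) \<le> \<epsilon> + C * (\<alpha> $ l * (u * (u - tanh u)))" if "\<bar>u\<bar> \<le> K" for u
      proof -
        have "0 \<le> u * tanh u"
          by (simp add: zero_le_mult_iff linear)
        then show "0 \<le> \<alpha> $ l * (u * tanh u)" using \<alpha> by simp
        have "u * tanh u \<le> u\<^sup>2"
          using tanh_gap_nonneg[of u] by (simp add: power2_eq_square algebra_simps)
        also have "\<dots> \<le> \<delta> + C * (u * (u - tanh u))" by (rule C[OF that])
        finally have "\<alpha> $ l * (u * tanh u) \<le> \<alpha> $ l * (\<delta> + C * (u * (u - tanh u)))"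
          using \<alpha> by (intro mult_left_mono)
        also have "\<dots> = \<alpha> $ l * \<delta> + C * (\<alpha> $ l * (u * (u - tanh u)))"
          by (simp add: algebra_simps)
        finally show "\<alpha> $ l * (u * tanh u) \<le> \<epsilon> + C * (\<alpha> $ l * (u * (u - tanh u)))"
          using \<delta> by linarith
      qed
      have "\<bar>\<alpha> $ l * q N l\<bar> \<le> cw_mean J (n N) (\<lambda>x. \<bar>\<alpha> $ l * (h N x $ l * tanh (h N x $ l))\<bar>)"
        unfolding q_def E_def cw_mean_cmult[symmetric] by (rule cw_mean_abs)
      also have "\<dots> \<le> cw_mean J (n N)
          (\<lambda>x. \<epsilon> + C * (\<alpha> $ l * (h N x $ l * (h N x $ l - tanh (h N x $ l)))))"
        using le[OF hK] by (intro cw_mean_mono) (metis abs_of_nonneg)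
      also have "\<dots> = \<epsilon> + C * g N l"
        unfolding g_def E_def by (simp add: cw_mean_add cw_mean_cmult)
      finally show ?thesis .
    qed
    then show "\<exists>C. \<forall>\<^sub>F N in sequentially. \<bar>\<alpha> $ l * q N l\<bar> \<le> \<epsilon> + C * g N l"
      by (intro exI[of _ C]) simp
  qed
  have D0: "D \<longlonglongrightarrow> 0"
  proof -
    have "(\<lambda>N. \<Sum>l\<in>UNIV. r N l + ((a N l - \<alpha> $ l) * q N l + \<alpha> $ l * q N l)) \<longlonglongrightarrow> 0"
      by (rule tendsto_null_sum) (intro tendsto_add_zero r0 aq0 alq0)
    moreover have "D = (\<lambda>N. \<Sum>l\<in>UNIV. r N l + ((a N l - \<alpha> $ l) * q N l + \<alpha> $ l * q N l))"
      by (simp add: fun_eq_iff D_eq algebra_simps)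
    ultimately show ?thesis by simp
  qed
  \<comment> \<open>From here on groups of proportion 0 are controlled as well, since this bound
    carries no factor \<alpha>.\<close>
  have h2_le: "E N (\<lambda>x. (h N x $ l)\<^sup>2) \<le> (1 + \<bar>J $ l $ l\<bar>) * D N" if "N \<ge> 1" for N
    unfolding D_def E_def cw_mean_cmult[symmetric] using h_le[OF that] by (intro cw_mean_mono)
  \<comment> \<open>The errors to come: the second moment of the field, the change 2 /
    \<open>n N l\<close> of the normalised sum under a flip, and the self-interaction. The second
    one vanishes because the group sizes tend to infinity.\<close>
  define b where "b N = (1 + \<bar>J $ l $ l\<bar>) * D N + (2 / real (n N l) + \<bar>J $ l $ l\<bar> / N)" for N
  have "(\<lambda>N. 2 / real (n N l)) \<longlonglongrightarrow> 0"
    by (rule tendsto_divide_0[OF tendsto_const filterlim_at_top_imp_at_infinity])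
       (rule filterlim_compose[OF filterlim_real_sequentially infty])
  then have b0: "b \<longlonglongrightarrow> 0"
    unfolding b_def by (intro tendsto_add_zero tendsto_mult_right_zero D0 lim_const_over_n)
  have n_pos: "\<forall>\<^sub>F N in sequentially. n N l \<ge> 1"
    using infty[of l] by (simp add: filterlim_at_top)
  show ?thesis
  proof (rule tendsto_zero_comparison[OF b0])
    fix \<epsilon> :: real assume \<epsilon>: "0 < \<epsilon>"
    have "\<forall>\<^sub>F N in sequentially. \<bar>cw_mean J (n N) (\<lambda>x. (spin_sum (n N) x $ l / real (n N l))\<^sup>2)\<bar>
        \<le> \<epsilon> + (1 + 1 / \<epsilon>) * b N"
      using n_pos eventually_ge_at_top[of 1]
    proof eventually_elim
      case (elim N)
      define y where "y x = s N x $ l / real (n N l)" for x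
      have y1: "\<bar>y x\<bar> \<le> 1" if "x \<in> spin_configs (n N)" for x
        using abs_spin_sum_le[OF that, of l] elim by (simp add: y_def s_def)
      have "\<bar>E N (\<lambda>x. (s N x $ l - n N l * tanh (h N x $ l)) * y x)\<bar>
          \<le> n N l * (2 / n N l + \<bar>J $ l $ l\<bar> * 1 / N)"
        unfolding E_def s_def h_def total'[OF elim(2), symmetric]
      proof (rule cw_mean_spin_sum_minus_tanh[OF sym])
        fix x i assume x: "x \<in> spin_configs (n N)" and i: "i \<in> {1..n N l}"
        show "\<bar>y x - y (flip_spin l i x)\<bar> \<le> 2 / n N l"
          unfolding y_def s_def spin_sum_flip_spin[where n = "n N" and l = l, OF i]
          using spin_configs_values[OF x i] by (auto simp: axis_def diff_divide_distrib)
      qed (rule y1)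
      from abs_le_D1[OF this]
      have "(1 / n N l) * E N (\<lambda>x. (s N x $ l - n N l * tanh (h N x $ l)) * y x)
          \<le> (1 / n N l) * (n N l * (2 / n N l + \<bar>J $ l $ l\<bar> * 1 / N))"
        by (rule mult_left_mono) simp
      also have "\<dots> = 2 / n N l + \<bar>J $ l $ l\<bar> / N"
        using elim by simp
      finally have 1: "(1 / n N l) * E N (\<lambda>x. (s N x $ l - n N l * tanh (h N x $ l)) * y x)
          \<le> 2 / n N l + \<bar>J $ l $ l\<bar> / N" .
      \<comment> \<open>One factor \<open>y\<close> serves as the test function; in the other, the
        group sum is split into its tanh part and the remainder just estimated.\<close>
      have "(\<lambda>x. (y x)\<^sup>2) = (\<lambda>x. (1 / n N l) * ((s N x $ l - n N l * tanh (h N x $ l)) * y x)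
          + tanh (h N x $ l) * y x)"
        using elim by (simp add: fun_eq_iff y_def power2_eq_square field_simps)
      then have "E N (\<lambda>x. (y x)\<^sup>2) = (1 / n N l) * E N (\<lambda>x. (s N x $ l - n N l * tanh (h N x $ l)) * y x)
          + E N (\<lambda>x. tanh (h N x $ l) * y x)"
        unfolding E_def by (simp only: cw_mean_add cw_mean_cmult)
      also have "\<dots> \<le> (2 / n N l + \<bar>J $ l $ l\<bar> / N) + E N (\<lambda>x. tanh (h N x $ l) * y x)"
        by (rule add_right_mono[OF 1])
      also have "E N (\<lambda>x. tanh (h N x $ l) * y x) \<le> E N (\<lambda>x. \<epsilon> + (1 / \<epsilon>) * (h N x $ l)\<^sup>2)"
        unfolding E_def
      proof (rule cw_mean_mono)
        fix x assume x: "x \<in> spin_configs (n N)"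
        define u where "u = h N x $ l"
        have "tanh u * y x \<le> \<bar>tanh u\<bar> * \<bar>y x\<bar>"
          by (metis abs_ge_self abs_mult)
        also have "\<dots> \<le> \<bar>u\<bar> * 1"
          using tanh_lipschitz[of u 0] y1[OF x] by (intro mult_mono) auto
        \<comment> \<open>The arithmetic-geometric mean inequality trades the first absolute moment
          of the field for the second, which is known to vanish.\<close>
        also have "\<bar>u\<bar> * 1 \<le> \<epsilon> + (1 / \<epsilon>) * u\<^sup>2"
        proof -
          have "\<bar>u\<bar> * \<epsilon> \<le> \<epsilon>\<^sup>2 + \<bar>u\<bar>\<^sup>2"
            using sum_squares_bound[of "\<bar>u\<bar>" \<epsilon>] \<epsilon> mult_nonneg_nonneg[of "\<bar>u\<bar>" \<epsilon>]
            by linarith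
          then show ?thesis using \<epsilon> by (simp add: field_simps power2_eq_square)
        qed
        finally show "tanh (h N x $ l) * y x \<le> \<epsilon> + (1 / \<epsilon>) * (h N x $ l)\<^sup>2"
          by (simp add: u_def)
      qed
      also have "\<dots> = \<epsilon> + (1 / \<epsilon>) * E N (\<lambda>x. (h N x $ l)\<^sup>2)"
        unfolding E_def by (simp only: cw_mean_add cw_mean_cmult cw_mean_const)
      also have "\<dots> \<le> \<epsilon> + (1 / \<epsilon>) * ((1 + \<bar>J $ l $ l\<bar>) * D N)"
        using h2_le[OF elim(2)] \<epsilon> by (intro add_left_mono mult_left_mono) auto
      finally have le: "E N (\<lambda>x. (y x)\<^sup>2)
        \<le> (2 / n N l + \<bar>J $ l $ l\<bar> / N) + (\<epsilon> + (1 / \<epsilon>) * ((1 + \<bar>J $ l $ l\<bar>) * D N))"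
        by simp
      define c1 where "c1 = (2 / n N l + \<bar>J $ l $ l\<bar> / N)"
      define c2 where "c2 = (1 + \<bar>J $ l $ l\<bar>) * D N"
      have c: "0 \<le> c1" "0 \<le> c2"
        unfolding c1_def c2_def
        using h2_le[OF elim(2)] cw_mean_mono[of "n N" "\<lambda>_. 0" "\<lambda>x. (h N x $ l)\<^sup>2" J]
        by (auto simp: E_def)
      have "E N (\<lambda>x. (y x)\<^sup>2) \<le> \<epsilon> + (c1 + (1 / \<epsilon>) * c2)"
        using le unfolding c1_def c2_def by linarith
      \<comment> \<open>Both coefficients are enlarged to 1 + 1/\<epsilon>, so that a single
        constant multiplies \<open>b N\<close>.\<close>
      also have "c1 + (1 / \<epsilon>) * c2 \<le> (1 + 1 / \<epsilon>) * (c2 + c1)"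
        using c \<epsilon> by (simp add: field_simps)
      also have "c2 + c1 = b N"
        by (simp add: b_def c1_def c2_def)
      finally have "E N (\<lambda>x. (y x)\<^sup>2) \<le> \<epsilon> + (1 + 1 / \<epsilon>) * b N" by simp
      moreover have "0 \<le> E N (\<lambda>x. (y x)\<^sup>2)"
        using cw_mean_mono[of "n N" "\<lambda>_. 0" "\<lambda>x. (y x)\<^sup>2" J] by (simp add: E_def)
      ultimately show ?case
        by (simp add: y_def s_def E_def)
    qed
    then show "\<exists>C. \<forall>\<^sub>F N in sequentially. \<bar>cw_mean J (n N) (\<lambda>x. (spin_sum (n N) x $ l / real (n N l))\<^sup>2)\<bar>
        \<le> \<epsilon> + C * b N" by blast
  qed
qed

section \<open>Weak convergence\<close>

text \<open>The events of observing a given configuration partition the sample space, and on each of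
  them \<open>G\<close> is constant. The integral is thus that of a simple function with the Gibbs
  probabilities as weights.\<close>

lemma curie_weiss_expectation:
  fixes J :: "real^'m^'m" and n :: "'m \<Rightarrow> nat" and P :: "'a measure"
  assumes cw: "curie_weiss J n P X"
    and G: "\<And>\<omega> x. \<omega> \<in> space P \<Longrightarrow> x \<in> spin_configs n \<Longrightarrow>
      (\<forall>l. \<forall>i\<in>{1..n l}. X l i \<omega> = x l i) \<Longrightarrow> G \<omega> = g x"
  shows "(\<integral>\<omega>. G \<omega> \<partial>P) = cw_mean J n g"
proof -
  interpret prob_space P using cw by (simp add: curie_weiss_def)
  define A where "A x = {\<omega> \<in> space P. \<forall>l. \<forall>i\<in>{1..n l}. X l i \<omega> = x l i}" for x
  have meas: "X l i \<in> borel_measurable P"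
    and val: "\<omega> \<in> space P \<Longrightarrow> X l i \<omega> \<in> {-1, 1}" if "i \<in> {1..n l}" for l i \<omega>
    using cw that unfolding curie_weiss_def by blast+
  have prob_A: "prob (A x) = cw_weight J n x / cw_partition J n" if "x \<in> spin_configs n" for x
    using cw that unfolding curie_weiss_def A_def by blast
  have A: "A x \<in> sets P" for x
    unfolding A_def
  proof (intro sets.sets_Collect_countable_All sets.sets_Collect_finite_All finite_atLeastAtMost)
    fix l i assume "i \<in> {1..n l}"
    then show "{\<omega> \<in> space P. X l i \<omega> = x l i} \<in> sets P"
      using meas by (intro borel_measurable_eq) auto
  qed
  \<comment> \<open>The observed configuration. Restriction makes it undefined outside the group, as
    membership in \<open>spin_configs\<close> demands, and this makes it the unique configuration
    compatible with the outcome.\<close>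
  define c where "c \<omega> = (\<lambda>l. \<lambda>i\<in>{1..n l}. X l i \<omega>)" for \<omega>
  have c: "c \<omega> \<in> spin_configs n" "\<omega> \<in> A (c \<omega>)" if "\<omega> \<in> space P" for \<omega>
  proof -
    show "c \<omega> \<in> spin_configs n"
      unfolding spin_configs_def c_def using val[OF _ that] by (intro CollectI allI restrict_PiE_iff[THEN iffD2] ballI)
    show "\<omega> \<in> A (c \<omega>)"
      using that unfolding A_def c_def by simp
  qed
  have uniq: "x = c \<omega>" if "x \<in> spin_configs n" "\<omega> \<in> A x" for x \<omega>
  proof (intro ext)
    fix l i
    show "x l i = c \<omega> l i"
    proof (cases "i \<in> {1..n l}")
      case True
      then show ?thesis using that(2) by (simp add: A_def c_def)
    next
      case False
      have "x l \<in> {1..n l} \<rightarrow>\<^sub>E {-1, 1}" using that(1) by (simp add: spin_configs_def)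
      then have "x l i = undefined" using False by (rule PiE_arb)
      then show ?thesis using False unfolding c_def restrict_def by (simp only: if_False)
    qed
  qed
  have "(\<integral>\<omega>. G \<omega> \<partial>P) = (\<integral>\<omega>. (\<Sum>x\<in>spin_configs n. g x * indicator (A x) \<omega>) \<partial>P)"
  proof (rule Bochner_Integration.integral_cong[OF refl])
    fix \<omega> assume \<omega>: "\<omega> \<in> space P"
    have "(\<Sum>x\<in>spin_configs n. g x * indicator (A x) \<omega>)
        = (\<Sum>x\<in>spin_configs n. if x = c \<omega> then g x else 0)"
    proof (rule sum.cong[OF refl])
      fix x assume "x \<in> spin_configs n"
      then have "\<omega> \<in> A x \<longleftrightarrow> x = c \<omega>"
        using uniq c(2)[OF \<omega>] by blast
      then show "g x * indicator (A x) \<omega> = (if x = c \<omega> then g x else 0)"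
        by (simp only: indicator_def of_bool_def if_distrib[of "(*) (g x)"] mult_1_right mult_zero_right)
    qed
    also have "\<dots> = g (c \<omega>)"
      using c[OF \<omega>] by (simp add: finite_spin_configs)
    also have "\<dots> = G \<omega>"
    proof (rule G[OF \<omega> c(1)[OF \<omega>], symmetric])
      show "\<forall>l. \<forall>i\<in>{1..n l}. X l i \<omega> = c \<omega> l i"
        using c(2)[OF \<omega>] unfolding A_def by blast
    qed
    finally show "G \<omega> = (\<Sum>x\<in>spin_configs n. g x * indicator (A x) \<omega>)" by simp
  qed
  also have "\<dots> = (\<Sum>x\<in>spin_configs n. \<integral>\<omega>. g x * indicator (A x) \<omega> \<partial>P)"
    by (intro Bochner_Integration.integral_sum integrable_mult_right integrable_real_indicator A)
       (simp add: less_top[symmetric])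
  also have "\<dots> = (\<Sum>x\<in>spin_configs n. g x * prob (A x))"
    using A sets.sets_into_space[OF A] by (simp add: Int_absorb2)
  also have "\<dots> = cw_mean J n g"
    unfolding cw_mean_def sum_divide_distrib
    by (intro sum.cong refl) (simp add: prob_A)
  finally show ?thesis .
qed

lemma borel_measurable_normalised_sums:
  assumes "curie_weiss J n P X"
  shows "normalised_sums n X \<in> borel_measurable P"
proof (subst borel_measurable_euclidean_space, intro ballI)
  fix b :: "real^'a" assume "b \<in> Basis"
  then obtain l where b: "b = axis l 1" by (auto simp: Basis_vec_def)
  have "X l i \<in> borel_measurable P" if "i \<in> {1..n l}" for i
    using assms that unfolding curie_weiss_def by blast
  then have "(\<lambda>\<omega>. (\<Sum>i=1..n l. X l i \<omega>) / real (n l)) \<in> borel_measurable P"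
    by (intro borel_measurable_divide borel_measurable_sum borel_measurable_const)
  then show "(\<lambda>\<omega>. normalised_sums n X \<omega> \<bullet> b) \<in> borel_measurable P"
    by (simp add: b normalised_sums_def inner_axis)
qed

text \<open>A Chebyshev argument carried out on the test function: continuity at 0 handles small
  vectors, boundedness together with the second moment handles the rest.\<close>

lemma converges_weakly_normalised_sums:
  fixes J :: "real^'m^'m" and n :: "nat \<Rightarrow> 'm \<Rightarrow> nat"
    and P :: "nat \<Rightarrow> 'a measure" and X :: "nat \<Rightarrow> 'm \<Rightarrow> nat \<Rightarrow> 'a \<Rightarrow> real"
  assumes cw: "\<And>N. N \<ge> 1 \<Longrightarrow> curie_weiss J (n N) (P N) (X N)"
    and second_moment:
      "\<And>l. (\<lambda>N. cw_mean J (n N) (\<lambda>x. (spin_sum (n N) x $ l / real (n N l))\<^sup>2)) \<longlonglongrightarrow> 0"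
  shows "converges_weakly (\<lambda>N. distr (P N) borel (normalised_sums (n N) (X N))) (return borel 0)"
  unfolding converges_weakly_def
proof (intro allI impI)
  fix f :: "real^'m \<Rightarrow> real"
  assume "continuous_on UNIV f \<and> bounded (range f)"
  then have cont: "continuous_on UNIV f" and "bounded (range f)" by auto
  then obtain B where B: "\<And>v. \<bar>f v\<bar> \<le> B"
    by (auto simp: bounded_iff)
  have f_borel: "f \<in> borel_measurable borel"
    using cont by (rule borel_measurable_continuous_onI)
  define u :: "nat \<Rightarrow> ('m \<Rightarrow> nat \<Rightarrow> real) \<Rightarrow> real^'m"
    where "u N x = (\<chi> l. spin_sum (n N) x $ l / real (n N l))" for N x
  define w where "w N = cw_mean J (n N) (\<lambda>x. (norm (u N x))\<^sup>2)" for N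
  have int: "(\<integral>v. f v \<partial>distr (P N) borel (normalised_sums (n N) (X N))) = cw_mean J (n N) (\<lambda>x. f (u N x))"
    if "N \<ge> 1" for N
  proof -
    have "(\<integral>v. f v \<partial>distr (P N) borel (normalised_sums (n N) (X N)))
        = (\<integral>\<omega>. f (normalised_sums (n N) (X N) \<omega>) \<partial>P N)"
      by (rule integral_distr[OF borel_measurable_normalised_sums[OF cw[OF that]] f_borel])
    also have "\<dots> = cw_mean J (n N) (\<lambda>x. f (u N x))"
      by (rule curie_weiss_expectation[OF cw[OF that]])
         (simp add: normalised_sums_def u_def spin_sum_def)
    finally show ?thesis .
  qed
  have "(\<lambda>N. \<Sum>l\<in>UNIV. cw_mean J (n N) (\<lambda>x. (spin_sum (n N) x $ l / real (n N l))\<^sup>2)) \<longlonglongrightarrow> 0"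
    by (rule tendsto_null_sum) (rule second_moment)
  then have w0: "w \<longlonglongrightarrow> 0"
    unfolding w_def by (simp add: u_def norm_vec_def L2_set_def sum_nonneg cw_mean_sum power_divide)
  have "(\<lambda>N. cw_mean J (n N) (\<lambda>x. f (u N x) - f 0)) \<longlonglongrightarrow> 0"
  proof (rule tendsto_zero_comparison[OF w0])
    fix \<epsilon> :: real assume \<epsilon>: "0 < \<epsilon>"
    obtain d where d: "0 < d" "\<And>v. norm v < d \<Longrightarrow> \<bar>f v - f 0\<bar> < \<epsilon>"
      using cont \<epsilon> unfolding continuous_on_iff by (auto simp: dist_real_def) (metis dist_0_norm dist_commute)
    \<comment> \<open>Outside the ball of radius \<open>d\<close> the quadratic term then exceeds 2
      * \<open>B\<close>, the largest possible variation of \<open>f\<close>.\<close>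
    define C where "C = 2 * B / d\<^sup>2"
    have B0: "0 \<le> B" using B[of 0] by linarith
    have le: "\<bar>f v - f 0\<bar> \<le> \<epsilon> + C * (norm v)\<^sup>2" for v
    proof (cases "norm v < d")
      case True
      then show ?thesis using d(2)[OF True] B0
        by (intro add_increasing2) (auto simp: C_def)
    next
      case False
      have "\<bar>f v - f 0\<bar> \<le> 2 * B" using B[of v] B[of 0] by linarith
      also have "\<dots> = C * d\<^sup>2" using d by (simp add: C_def)
      also have "\<dots> \<le> C * (norm v)\<^sup>2"
        using False d B0 by (intro mult_left_mono power_mono) (auto simp: C_def)
      finally show ?thesis using \<epsilon> by linarith
    qed
    have "\<bar>cw_mean J (n N) (\<lambda>x. f (u N x) - f 0)\<bar> \<le> \<epsilon> + C * w N" for N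
    proof -
      have "\<bar>cw_mean J (n N) (\<lambda>x. f (u N x) - f 0)\<bar> \<le> cw_mean J (n N) (\<lambda>x. \<bar>f (u N x) - f 0\<bar>)"
        by (rule cw_mean_abs)
      also have "\<dots> \<le> cw_mean J (n N) (\<lambda>x. \<epsilon> + C * (norm (u N x))\<^sup>2)"
        by (intro cw_mean_mono le)
      also have "\<dots> = \<epsilon> + C * w N"
        by (simp add: w_def cw_mean_add cw_mean_cmult)
      finally show ?thesis .
    qed
    then show "\<exists>C. \<forall>\<^sub>F N in sequentially. \<bar>cw_mean J (n N) (\<lambda>x. f (u N x) - f 0)\<bar> \<le> \<epsilon> + C * w N"
      by (intro exI[of _ C]) simp
  qed
  then have "(\<lambda>N. cw_mean J (n N) (\<lambda>x. f (u N x))) \<longlonglongrightarrow> f 0"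
    by (simp add: cw_mean_diff LIM_zero_iff)
  \<comment> \<open>The model is given only from N = 1 on, so the integrals and the Gibbs averages
    agree eventually.\<close>
  moreover have "\<forall>\<^sub>F N in sequentially. cw_mean J (n N) (\<lambda>x. f (u N x)) =
      (\<integral>v. f v \<partial>distr (P N) borel (normalised_sums (n N) (X N)))"
    using eventually_ge_at_top[of 1] by eventually_elim (simp add: int)
  ultimately have "(\<lambda>N. \<integral>v. f v \<partial>distr (P N) borel (normalised_sums (n N) (X N))) \<longlonglongrightarrow> f 0"
    by (rule Lim_transform_eventually)
  then show "(\<lambda>N. \<integral>v. f v \<partial>distr (P N) borel (normalised_sums (n N) (X N))) \<longlonglongrightarrow>
      (\<integral>v. f v \<partial>return borel 0)"
    by (simp add: integral_return f_borel)
qed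

section \<open>The critical regimes\<close>

text \<open>All components of \<open>J *v v\<close> equal the sum of the entries of
  \<open>v\<close>. As the proportions add up to 1, both sides are the square of that sum: at
  \<beta> = 1 domination holds with equality.\<close>

lemma homogeneous_domination:
  fixes J :: "real^'m^'m" and \<alpha> :: "real^'m"
  assumes "homogeneous_coupling 1 J" and "(\<Sum>l\<in>UNIV. \<alpha> $ l) = 1"
  shows "(\<Sum>l\<in>UNIV. \<alpha> $ l * ((J *v v) $ l)\<^sup>2) \<le> v \<bullet> (J *v v)"
proof -
  have "J *v v = (\<chi> l. \<Sum>m\<in>UNIV. v $ m)"
    using assms(1) by (simp add: homogeneous_coupling_def matrix_vector_mult_def)
  then show ?thesis
    using assms(2) by (simp add: inner_vec_def power2_eq_square flip: sum_distrib_right)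
qed

lemma matrix_inv_left_pos_def:
  assumes "pos_def J"
  shows "matrix_inv J ** J = mat 1"
proof -
  have "x = 0" if "J *v x = 0" for x
  proof (rule ccontr)
    assume "x \<noteq> 0"
    then have "0 < x \<bullet> (J *v x)" using assms by (simp add: pos_def_def)
    with that show False by simp
  qed
  then have "invertible J"
    unfolding invertible_left_inverse matrix_left_invertible_ker by blast
  then have "\<exists>A'. J ** A' = mat 1 \<and> A' ** J = mat 1"
    by (simp add: invertible_def)
  \<comment> \<open>\<open>matrix_inv\<close> is a choice of a two-sided inverse, so it is one as
    soon as an inverse exists.\<close>
  from someI_ex[OF this] show ?thesis
    unfolding matrix_inv_def by blast
qed

lemma diag_matrix_mult_vector: "(diag_matrix a *v v) $ l = a $ l * v $ l"
  by (simp add: diag_matrix_def matrix_vector_mult_def if_distrib[of "\<lambda>x. x * _"] cong: if_cong)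

text \<open>With \<open>w = J *v v\<close> the right-hand side is the quadratic form of the inverse
  of \<open>J\<close> at \<open>w\<close>, and the left-hand side that of the diagonal matrix of
  proportions. The claim is the nonnegativity of H at \<open>w\<close>.\<close>

lemma heterogeneous_domination:
  fixes J :: "real^'m^'m" and \<alpha> :: "real^'m"
  assumes "heterogeneous_coupling J" and "heterogeneous_critical \<alpha> J"
  shows "(\<Sum>l\<in>UNIV. \<alpha> $ l * ((J *v v) $ l)\<^sup>2) \<le> v \<bullet> (J *v v)"
proof -
  define w where "w = J *v v"
  have "matrix_inv J *v w = v"
    using matrix_inv_left_pos_def[of J] assms(1)
    by (simp add: w_def heterogeneous_coupling_def matrix_vector_mul_assoc)
  moreover have "0 \<le> w \<bullet> ((matrix_inv J - diag_matrix \<alpha>) *v w)"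
    using assms(2) by (simp add: heterogeneous_critical_def Let_def pos_semidef_def)
  ultimately have "w \<bullet> (diag_matrix \<alpha> *v w) \<le> w \<bullet> v"
    by (simp add: matrix_vector_mult_diff_rdistrib inner_diff_right)
  then show ?thesis
    unfolding w_def[symmetric] inner_commute[of v]
    by (simp add: inner_vec_def[of w "_ *v _"] diag_matrix_mult_vector power2_eq_square mult_ac)
qed

theorem theorem13:
  fixes J :: "real^'m^'m"
    and \<alpha> :: "real^'m"
    and Ns :: "nat \<Rightarrow> 'm \<Rightarrow> nat"
    and P :: "nat \<Rightarrow> 'a measure"
    and X :: "nat \<Rightarrow> 'm \<Rightarrow> nat \<Rightarrow> 'a \<Rightarrow> real"
  assumes "pos_semidef J"
    and "\<And>N. N \<ge> 1 \<Longrightarrow> (\<Sum>l\<in>UNIV. Ns N l) = N"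
    and "\<And>l. filterlim (\<lambda>N. Ns N l) at_top sequentially"
    and "\<And>l. (\<lambda>N. real (Ns N l) / real N) \<longlonglongrightarrow> \<alpha> $ l"
    and "\<And>l. 0 \<le> \<alpha> $ l"
    and "(\<Sum>l\<in>UNIV. \<alpha> $ l) = 1"
    and "\<And>N. N \<ge> 1 \<Longrightarrow> curie_weiss J (Ns N) (P N) (X N)"
  shows "(\<forall>\<beta>. homogeneous_coupling \<beta> J \<and> \<beta> = 1 \<longrightarrow>
            converges_weakly (\<lambda>N. distr (P N) borel (normalised_sums (Ns N) (X N)))
              (return borel 0)) \<and>
         (CARD('m) = 2 \<and> heterogeneous_coupling J \<and> heterogeneous_critical \<alpha> J \<longrightarrow>
            converges_weakly (\<lambda>N. distr (P N) borel (normalised_sums (Ns N) (X N)))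
              (return borel 0))"
proof -
  \<comment> \<open>Both claims follow from the domination inequality alone, which each critical
    regime supplies.\<close>
  have "converges_weakly (\<lambda>N. distr (P N) borel (normalised_sums (Ns N) (X N))) (return borel 0)"
    if "\<And>v. (\<Sum>l\<in>UNIV. \<alpha> $ l * ((J *v v) $ l)\<^sup>2) \<le> v \<bullet> (J *v v)"
    using assms(7) cw_mean_square_normalised_sum_tendsto_0[OF assms(1-5) that]
    by (rule converges_weakly_normalised_sums)
  then show ?thesis
    using homogeneous_domination[OF _ assms(6)] heterogeneous_domination by blast
qed

end
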